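(* Let $f:\operatorname{dom}(f)\subseteq\mathbb{R}^n\to\mathbb{R}$, let $\mathcal{X}=\langle x^0,x^0+d^1,\ldots,x^0+d^m\rangle$ be an ordered set of $m+1$ distinct points such that $\mathcal{X}\cup\mathcal{X}^-$ is contained in $\operatorname{dom}(f)$, and let $k$ be a positive integer. Then $$\nabla^c f^k(\mathcal{X})=k\,(f(x^0))^{k-1}\,\nabla^c f(\mathcal{X})+E^c_{f^k}(\mathcal{X}),$$ where $E^c_{f^k}(\mathcal{X})=\tfrac12\big(E^s_{f^k}(\mathcal{X})+E^s_{f^k}(\mathcal{X}^-)\big)$ and, for $\mathcal{Z}\in\{\mathcal{X},\mathcal{X}^-\}$, $$E^s_{f^k}(\mathcal{Z})=(S(\mathcal{Z})^\top)^\dagger\sum_{i=1}^{k-1}(f(x^0))^{k-1-i}\,\delta^s_{f|f^i}(\mathcal{Z}).$$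
   Context: $A^\dagger$ denotes the Moore--Penrose pseudoinverse of a matrix $A$; $0^0=1$. For an ordered set $\mathcal{Z}=\langle z^0,z^0+e^1,\ldots,z^0+e^m\rangle$ in $\mathbb{R}^n$ put $S(\mathcal{Z})=[e^1\ \cdots\ e^m]\in\mathbb{R}^{n\times m}$ and $\mathcal{Z}^-=\langle z^0,z^0-e^1,\ldots,z^0-e^m\rangle$ (so $S(\mathcal{Z}^-)=-S(\mathcal{Z})$). The generalized centred simplex gradient of a real-valued function $h$ over $\mathcal{Z}$ is $\nabla^c h(\mathcal{Z})=(S(\mathcal{Z})^\top)^\dagger\delta^c_h(\mathcal{Z})$, where $\delta^c_h(\mathcal{Z})\in\mathbb{R}^m$ has $i$-th entry $\tfrac12\big(h(z^0+e^i)-h(z^0-e^i)\big)$. The product difference vector of functions $u,v$ is $\delta^s_{u|v}(\mathcal{Z})\in\mathbb{R}^m$ with $i$-th entry $\big(u(z^0+e^i)-u(z^0)\big)\big(v(z^0+e^i)-v(z^0)\big)$. Here $f^k$ is the pointwise $k$-th power. *)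

theory Defs
  imports "HOL-Analysis.Analysis"
begin

section \<open>The Moore--Penrose pseudoinverse of a real matrix\<close>

definition moore_penrose :: "real^'n^'m \<Rightarrow> real^'m^'n \<Rightarrow> bool" where
  "moore_penrose A B \<longleftrightarrow>
     A ** B ** A = A \<and> B ** A ** B = B \<and>
     transpose (A ** B) = A ** B \<and> transpose (B ** A) = B ** A"

definition pinv :: "real^'n^'m \<Rightarrow> real^'m^'n" where
  "pinv A = (THE B. moore_penrose A B)"

lemma ex_generalized_inverse:
  fixes A :: "real^'n^'m"
  shows "\<exists>G :: real^'m^'n. A ** G ** A = A"
proof -
  obtain g where g: "linear g" "\<And>v. A *v g (A *v v) = A *v v"
    using linear_exists_right_inverse_on[OF matrix_vector_mul_linear[of A] subspace_UNIV]
    by auto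
  have "A ** matrix g ** A = A"
    unfolding matrix_eq
    by (simp add: matrix_vector_mul_assoc[symmetric] matrix_works[OF g(1)[unfolded linear_matrix_vector_mul_eq[symmetric]]] g)
  thus ?thesis by blast
qed

lemma transpose_mult_cancel:
  fixes A :: "real^'n^'m" and X Y :: "real^'p^'n"
  assumes "transpose A ** (A ** X) = transpose A ** (A ** Y)"
  shows "A ** X = A ** Y"
proof -
  have "A *v (X *v v) = A *v (Y *v v)" for v
  proof -
    define w where "w = X *v v - Y *v v"
    have "transpose A *v (A *v w) = 0"
      using arg_cong[OF assms, of "\<lambda>M. M *v v"]
      by (simp add: w_def matrix_vector_mul_assoc[symmetric] matrix_vector_mult_diff_distrib)
    hence "(A *v w) \<bullet> (A *v w) = 0"
      by (metis dot_lmul_matrix inner_zero_right inner_commute transpose_matrix_vector)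
    thus ?thesis by (simp add: w_def matrix_vector_mult_diff_distrib)
  qed
  thus ?thesis by (simp add: matrix_eq matrix_vector_mul_assoc[symmetric])
qed

lemma ex_orthogonal_projection:
  fixes A :: "real^'n^'m"
  shows "\<exists>B :: real^'m^'n. A ** B ** A = A \<and> transpose (A ** B) = A ** B"
proof -
  obtain G where G: "transpose A ** A ** G ** (transpose A ** A) = transpose A ** A"
    using ex_generalized_inverse by blast
  define B where "B = G ** transpose A"
  have 1: "A ** (B ** A) = A ** mat 1"
    by (rule transpose_mult_cancel) (use G in \<open>simp add: B_def matrix_mul_assoc\<close>)
  define P where "P = A ** B"
  have PA: "P ** A = A" using 1 by (simp add: P_def matrix_mul_assoc)
  have "P ** transpose P = P"
  proof -
    have "transpose A ** transpose P = transpose A"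
      using PA by (metis matrix_transpose_mul)
    thus ?thesis by (simp add: P_def B_def matrix_mul_assoc[symmetric])
  qed
  hence "transpose P = P"
    by (metis matrix_transpose_mul transpose_transpose)
  thus ?thesis using PA unfolding P_def by blast
qed

lemma ex1_moore_penrose:
  fixes A :: "real^'n^'m"
  shows "\<exists>!B. moore_penrose A B"
proof -
  obtain B :: "real^'m^'n" where B: "A ** B ** A = A" "transpose (A ** B) = A ** B"
    using ex_orthogonal_projection by blast
  obtain D :: "real^'n^'m" where D: "transpose A ** D ** transpose A = transpose A"
      "transpose (transpose A ** D) = transpose A ** D"
    using ex_orthogonal_projection by blast
  define C where "C = transpose D"
  have C: "A ** C ** A = A" "transpose (C ** A) = C ** A"
    using arg_cong[OF D(1), of transpose] D(2)
    by (simp_all add: C_def matrix_transpose_mul matrix_mul_assoc)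
  define X where "X = C ** A ** B"
  have AX: "A ** X = A ** B" by (simp add: X_def matrix_mul_assoc C)
  have XA: "X ** A = C ** A" by (simp add: X_def matrix_mul_assoc[symmetric] B[simplified matrix_mul_assoc[symmetric]])
  have "X ** A ** X = X"
    unfolding XA by (metis C(1) X_def matrix_mul_assoc)
  hence "moore_penrose A X"
    unfolding moore_penrose_def using AX XA B C by simp
  moreover have "Y = Z" if Y: "moore_penrose A Y" and Z: "moore_penrose A Z" for Y Z
  proof -
    note y = Y[unfolded moore_penrose_def] and z = Z[unfolded moore_penrose_def]
    have 1: "A ** Y = A ** Z"
    proof -
      have "A ** Y = transpose (A ** Z ** (A ** Y))"
        using y z by (simp add: matrix_mul_assoc)
      also have "\<dots> = A ** Y ** (A ** Z)"
        using y z by (metis matrix_transpose_mul)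
      also have "\<dots> = A ** Z" using y by (simp add: matrix_mul_assoc)
      finally show ?thesis .
    qed
    have 2: "Y ** A = Z ** A"
    proof -
      have "Y ** A = transpose (Y ** A ** (Z ** A))"
        using y z by (metis matrix_mul_assoc)
      also have "\<dots> = Z ** A ** (Y ** A)"
        using y z by (metis matrix_transpose_mul)
      also have "\<dots> = Z ** A" using y by (metis matrix_mul_assoc)
      finally show ?thesis .
    qed
    have "Y = Y ** A ** Y" using y by simp
    also have "\<dots> = Z ** A ** Z" using 1 2 by (metis matrix_mul_assoc)
    also have "\<dots> = Z" using z by simp
    finally show ?thesis .
  qed
  ultimately show ?thesis by blast
qed

lemma moore_penrose_pinv: "moore_penrose A (pinv A)"
  unfolding pinv_def by (rule theI'[OF ex1_moore_penrose])

lemma pinv_eqI: "moore_penrose A B \<Longrightarrow> pinv A = B"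
  using ex1_moore_penrose moore_penrose_pinv by blast


section \<open>Ordered sample sets and simplex gradients\<close>

text \<open>
  The ordered set \<open>\<langle>z0, z0 + e 1, \<dots>, z0 + e m\<rangle>\<close> is represented by the pair \<open>(z0, e)\<close>,
  with the directions indexed by a finite type \<open>'m\<close>, \<open>m = CARD('m)\<close>.
\<close>
type_synonym ('n, 'm) sample = "(real, 'n) vec \<times> ('m \<Rightarrow> (real, 'n) vec)"

definition points :: "('n::finite, 'm::finite) sample \<Rightarrow> (real^'n) set" where
  "points Z = (case Z of (z0, e) \<Rightarrow> insert z0 (range (\<lambda>i. z0 + e i)))"

definition reflect :: "('n::finite, 'm::finite) sample \<Rightarrow> ('n, 'm) sample" where
  "reflect Z = (case Z of (z0, e) \<Rightarrow> (z0, \<lambda>i. - e i))"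

definition dir_matrix :: "('n::finite, 'm::finite) sample \<Rightarrow> real^'m^'n" where
  "dir_matrix Z = (case Z of (z0, e) \<Rightarrow> (\<chi> r c. e c $ r))"

definition delta_c :: "(real^'n \<Rightarrow> real) \<Rightarrow> ('n::finite, 'm::finite) sample \<Rightarrow> real^'m" where
  "delta_c h Z = (case Z of (z0, e) \<Rightarrow> (\<chi> i. (h (z0 + e i) - h (z0 - e i)) / 2))"

definition centred_simplex_gradient ::
    "(real^'n \<Rightarrow> real) \<Rightarrow> ('n::finite, 'm::finite) sample \<Rightarrow> real^'n" where
  "centred_simplex_gradient h Z = pinv (transpose (dir_matrix Z)) *v delta_c h Z"

definition delta_s ::
    "(real^'n \<Rightarrow> real) \<Rightarrow> (real^'n \<Rightarrow> real) \<Rightarrow> ('n::finite, 'm::finite) sample \<Rightarrow> real^'m" where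
  "delta_s u v Z = (case Z of (z0, e) \<Rightarrow>
     (\<chi> i. (u (z0 + e i) - u z0) * (v (z0 + e i) - v z0)))"

definition E_s :: "(real^'n \<Rightarrow> real) \<Rightarrow> nat \<Rightarrow> ('n::finite, 'm::finite) sample \<Rightarrow> real^'n" where
  "E_s f k Z = pinv (transpose (dir_matrix Z)) *v
     (\<Sum>i = 1..k - 1. f (fst Z) ^ (k - 1 - i) *\<^sub>R delta_s f (\<lambda>x. f x ^ i) Z)"

definition E_c :: "(real^'n \<Rightarrow> real) \<Rightarrow> nat \<Rightarrow> ('n::finite, 'm::finite) sample \<Rightarrow> real^'n" where
  "E_c f k Z = (1 / 2) *\<^sub>R (E_s f k Z + E_s f k (reflect Z))"

end

theory Submission
  imports Defs
begin

text \<open>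
  Write \<open>a\<close>, \<open>p\<close>, \<open>q\<close> for the values of \<open>f\<close> at the centre, at \<open>x0 + d i\<close> and at \<open>x0 - d i\<close>.
  Telescoping \<open>p ^ k - a ^ k = (p - a) * (\<Sum>i<k. a ^ (k - 1 - i) * p ^ i)\<close> and replacing each
  \<open>p ^ i\<close> by \<open>a ^ i + (p ^ i - a ^ i)\<close> gives
  \<open>p ^ k - a ^ k = k * a ^ (k - 1) * (p - a) + R p\<close> with the exact remainder
  \<open>R p = (\<Sum>i = 1..k-1. a ^ (k - 1 - i) * ((p - a) * (p ^ i - a ^ i)))\<close>
  (\<open>power_diff_linear_remainder\<close>). The vector with entries \<open>R p\<close> is the one to which \<open>E_s\<close> applies
  the pseudoinverse over the sample set, and the vector with entries \<open>R q\<close> is the one for the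
  reflected set. Subtracting the expansion of \<open>q\<close> from that of \<open>p\<close> cancels \<open>a ^ k\<close>
  and expresses the centred differences of \<open>f ^ k\<close> through those of \<open>f\<close> and \<open>R p - R q\<close>.

  The definition of \<open>E_c\<close> adds the two error terms although the remainders have to be subtracted:
  reflection negates the direction matrix, hence also its pseudoinverse (\<open>pinv_uminus\<close>), and this
  sign turns the sum into the required difference. The rest is linearity of one and the same
  matrix applied to an identity between vectors.
\<close>

lemma power_diff_linear_remainder:
  fixes a p :: "'a::comm_ring_1"
  assumes "k > 0"
  shows "p ^ k - a ^ k = of_nat k * a ^ (k - 1) * (p - a)
           + (\<Sum>i = 1..k - 1. a ^ (k - 1 - i) * ((p - a) * (p ^ i - a ^ i)))"
proof -
  \<comment> \<open>The term for \<open>i = 0\<close> vanishes because \<open>p ^ 0 = a ^ 0\<close>, so the sum may start there.\<close>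
  have "(\<Sum>i = 1..k - 1. a ^ (k - 1 - i) * ((p - a) * (p ^ i - a ^ i)))
      = (\<Sum>i<k. a ^ (k - 1 - i) * ((p - a) * (p ^ i - a ^ i)))"
    by (rule sum.mono_neutral_left) (use assms in \<open>auto simp: not_le\<close>)
  also have "\<dots> = (\<Sum>i<k. (p - a) * (a ^ (k - Suc i) * p ^ i) - a ^ (k - 1) * (p - a))"
  proof (rule sum.cong)
    fix i assume "i \<in> {..<k}"
    hence "a ^ (k - Suc i) * a ^ i = a ^ (k - 1)"
      by (simp add: power_add[symmetric])
    thus "a ^ (k - 1 - i) * ((p - a) * (p ^ i - a ^ i))
        = (p - a) * (a ^ (k - Suc i) * p ^ i) - a ^ (k - 1) * (p - a)"
      by (simp add: algebra_simps)
  qed simp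
  also have "\<dots> = (p ^ k - a ^ k) - of_nat k * a ^ (k - 1) * (p - a)"
    by (simp add: sum_subtractf sum_distrib_left[symmetric] power_diff_sumr2 mult.assoc)
  finally show ?thesis by simp
qed

text \<open>
  In \<open>A ** B\<close> and \<open>B ** A\<close> the two signs cancel, and each side of \<open>A ** B ** A = A\<close> and
  \<open>B ** A ** B = B\<close> changes sign once.
\<close>

lemma pinv_uminus: "pinv (- A) = - pinv A"
proof (rule pinv_eqI)
  have neg: "(- M) ** N = - (M ** N)" "M ** (- N) = - (M ** N)"
    for M :: "real^'p^'q" and N :: "real^'r^'p"
    by (simp_all add: matrix_matrix_mult_def vec_eq_iff sum_negf)
  show "moore_penrose (- A) (- pinv A)"
    using moore_penrose_pinv[of A] by (simp add: moore_penrose_def neg)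
qed

lemma dir_matrix_reflect: "dir_matrix (reflect Z) = - dir_matrix Z"
  by (simp add: dir_matrix_def reflect_def vec_eq_iff split: prod.split)

text \<open>
  Both error terms are brought over the common matrix, where the sign from the reflection makes the
  remainders at \<open>x0 + d i\<close> and \<open>x0 - d i\<close> enter with opposite signs.
\<close>

lemma E_c_eq_pinv_remainder_diff:
  "E_c f k Z = pinv (transpose (dir_matrix Z)) *v ((1 / 2) *\<^sub>R
     ((\<Sum>i = 1..k - 1. f (fst Z) ^ (k - 1 - i) *\<^sub>R delta_s f (\<lambda>x. f x ^ i) Z)
      - (\<Sum>i = 1..k - 1. f (fst Z) ^ (k - 1 - i) *\<^sub>R delta_s f (\<lambda>x. f x ^ i) (reflect Z))))"
proof -
  have transpose_neg: "transpose (- M) = - transpose M" for M :: "real^'p^'q"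
    by (simp add: transpose_def vec_eq_iff)
  have neg_mult: "(- M) *v v = - (M *v v)" for M :: "real^'p^'q" and v
    by (simp add: matrix_vector_mult_def vec_eq_iff sum_negf)
  have "fst (reflect Z) = fst Z"
    by (simp add: reflect_def split: prod.split)
  thus ?thesis
    by (simp add: E_c_def E_s_def dir_matrix_reflect transpose_neg pinv_uminus neg_mult
        matrix_vector_mult_scaleR matrix_vector_mult_diff_distrib)
qed

theorem corollary4p4:
  fixes f :: "real^'n \<Rightarrow> real" and domf :: "(real^'n) set"
    and x0 :: "real^'n" and d :: "'m::finite \<Rightarrow> real^'n" and k :: nat
  assumes "card (points (x0, d)) = CARD('m) + 1"
    and "points (x0, d) \<union> points (reflect (x0, d)) \<subseteq> domf"
    and "k > 0"
  shows "centred_simplex_gradient (\<lambda>x. f x ^ k) (x0, d) =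
           (real k * f x0 ^ (k - 1)) *\<^sub>R centred_simplex_gradient f (x0, d) + E_c f k (x0, d)"
proof -
  let ?Z = "(x0, d)"
  let ?R = "\<lambda>Z. \<Sum>i = 1..k - 1. f x0 ^ (k - 1 - i) *\<^sub>R delta_s f (\<lambda>x. f x ^ i) Z"
  have "delta_c (\<lambda>x. f x ^ k) ?Z
      = (real k * f x0 ^ (k - 1)) *\<^sub>R delta_c f ?Z + (1 / 2) *\<^sub>R (?R ?Z - ?R (reflect ?Z))"
    unfolding vec_eq_iff
  proof
    fix j
    have "?R ?Z $ j = f (x0 + d j) ^ k - f x0 ^ k
        - real k * f x0 ^ (k - 1) * (f (x0 + d j) - f x0)"
      using power_diff_linear_remainder[OF \<open>k > 0\<close>, of "f (x0 + d j)" "f x0"]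
      by (simp add: delta_s_def)
    moreover have "?R (reflect ?Z) $ j = f (x0 - d j) ^ k - f x0 ^ k
        - real k * f x0 ^ (k - 1) * (f (x0 - d j) - f x0)"
      using power_diff_linear_remainder[OF \<open>k > 0\<close>, of "f (x0 - d j)" "f x0"]
      by (simp add: delta_s_def reflect_def)
    ultimately show "delta_c (\<lambda>x. f x ^ k) ?Z $ j
        = ((real k * f x0 ^ (k - 1)) *\<^sub>R delta_c f ?Z
            + (1 / 2) *\<^sub>R (?R ?Z - ?R (reflect ?Z))) $ j"
      by (simp only: vector_add_component vector_minus_component vector_scaleR_component)
        (simp add: delta_c_def field_simps)
  qed
  thus ?thesis
    by (simp add: centred_simplex_gradient_def E_c_eq_pinv_remainder_diff
        matrix_vector_right_distrib matrix_vector_mult_scaleR)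
qed

end
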